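(* Let $\nu\ge3$, $X=Sp(2\nu,2)$, and let $S,T,S_0,S_2,S_4$ be as in the context. Then the following hold. (i) For any $x\in S$: $|N(x)\cap P|=0$ if $P=T$ or $P=S_0\setminus(S\cup T)$; $|N(x)\cap P|=|P|$ if $P=S_4$; $|N(x)\cap P|=\frac12|P|$ if $P=S_2$. (ii) For any $x\in S_4$: $|N(x)\cap P|=0$ if $P=T$; $|N(x)\cap P|=|P|$ if $P=S$; $|N(x)\cap P|=\frac12|P|$ if $P=S_2$ or $P=S_0\setminus(S\cup T)$. (iii) For any $x\in S_0\setminus(S\cup T)$: $|N(x)\cap P|=0$ if $P=S$ or $P=T$; $|N(x)\cap P|=\frac12|P|$ if $P=S_2$ or $P=S_4$. In particular, $S$, $S_0\setminus(S\cup T)$ and $S_4$ are Godsil–McKay cells of the partition $\{S,T,S_0\setminus(S\cup T),S_2,S_4\}$ of $V(X)$.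
   Context: $N(x)$ is the set of neighbors of $x$. Let $R=\begin{bmatrix}0&1\\1&0\end{bmatrix}$ and $K=I_\nu\otimes R$ over $\mathbb{F}_2$. The symplectic graph $Sp(2\nu,2)$ has vertex set $\mathbb{F}_2^{2\nu}\setminus\{\mathbf 0\}$, with $x,y$ adjacent iff $x^TKy=1$. Fix $S=\{v_1,v_2,v_3,v_4\}\subset V(X)$, where $v_1,v_2,v_3$ are linearly independent, $v_i^TKv_j=0$ for all $i,j\in\{1,2,3\}$, and $v_4=v_1+v_2+v_3$. For $i=0,2,4$ let $S_i=\{x\in V(X):\#\{j\in\{1,2,3,4\}:x^TKv_j=1\}=i\}$; then $V(X)=S_0\sqcup S_2\sqcup S_4$. Let $T=\{v_1+v_2,v_2+v_3,v_3+v_1\}$; then $S,T\subset S_0$. The partition $\{S,T,S_0\setminus(S\cup T),S_2,S_4\}$ is the orbit partition of $\{g\in\mathrm{Aut}(X):S^g=S\}$ on $V(X)$. A cell $D$ of a partition $\{C_1,\dots,C_t,D\}$ of $V(X)$ is a Godsil–McKay cell if (i) for all $i,j\in\{1,\dots,t\}$ any two vertices of $C_i$ have the same number of neighbors in $C_j$, and (ii) for every $x\in D$ and every $i\in\{1,\dots,t\}$, $|N(x)\cap C_i|\in\{0,\frac12|C_i|,|C_i|\}$. When $\nu=3$ the set $S_0\setminus(S\cup T)$ is empty; members of a partition are allowed to be empty here, and statements about this set are then vacuous. *)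

theory Defs
  imports
    "HOL-Analysis.Analysis"
    "HOL-Library.Z2"
    "HOL-Library.Disjoint_Sets"
    "HOL-Library.Numeral_Type"
    "Graph_Theory.Graph_Theory"
begin

text \<open>
  The field \<open>\<bbbF>\<^sub>2\<close> is the type \<open>bit\<close>.  With \<open>\<nu> = CARD('n)\<close>, a vector of
  \<open>\<bbbF>\<^sub>2\<^bsup>2\<nu>\<^esup>\<close> has type \<open>bit ^ ('n \<times> 2)\<close>: the pair index \<open>(i, a)\<close> names the \<open>a\<close>-th
  entry of the \<open>i\<close>-th block of length 2, which is how the rows and columns of the
  Kronecker product \<open>I\<^sub>\<nu> \<otimes> R\<close> are indexed.
\<close>

instance bit :: finite
proof
  have "(UNIV :: bit set) \<subseteq> {0, 1}" by (auto simp: Z2.bit_not_zero_iff)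
  then show "finite (UNIV :: bit set)" by (rule finite_subset) simp
qed

definition kronecker :: "'a::times ^ 'n ^ 'm \<Rightarrow> 'a ^ 'q ^ 'p \<Rightarrow> 'a ^ ('n \<times> 'q) ^ ('m \<times> 'p)"
  where "kronecker A B = (\<chi> r c. A $ fst r $ fst c * B $ snd r $ snd c)"

definition R :: "bit ^ 2 ^ 2"
  where "R = vector [vector [0, 1], vector [1, 0]]"

definition K :: "bit ^ ('n \<times> 2) ^ ('n::finite \<times> 2)"
  where "K = kronecker (mat 1) R"

text \<open>The form \<open>x\<^sup>T K y\<close>.\<close>

definition symp_form :: "bit ^ ('n::finite \<times> 2) \<Rightarrow> bit ^ ('n \<times> 2) \<Rightarrow> bit"
  where "symp_form x y = scalar_product x (K *v y)"

definition Sp :: "(bit ^ ('n::finite \<times> 2)) pair_pre_digraph"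
  where "Sp = \<lparr> pverts = UNIV - {0},
                parcs = {(x, y). x \<noteq> 0 \<and> y \<noteq> 0 \<and> symp_form x y = 1} \<rparr>"

definition neighbors :: "'a pair_pre_digraph \<Rightarrow> 'a \<Rightarrow> 'a set"
  where "neighbors G x = {y \<in> pverts G. (x, y) \<in> parcs G}"

text \<open>
  Unlike in \<^const>\<open>partition_on\<close>, the cells of the partition \<open>P\<close> may be empty.
\<close>

definition godsil_mckay_cell :: "'a pair_pre_digraph \<Rightarrow> 'a set set \<Rightarrow> 'a set \<Rightarrow> bool"
  where "godsil_mckay_cell G P D \<longleftrightarrow>
    finite P \<and> \<Union>P = pverts G \<and> disjoint P \<and> D \<in> P \<and>
    (\<forall>A \<in> P - {D}. \<forall>B \<in> P - {D}. \<forall>x \<in> A. \<forall>y \<in> A.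
       card (neighbors G x \<inter> B) = card (neighbors G y \<inter> B)) \<and>
    (\<forall>x \<in> D. \<forall>C \<in> P - {D}.
       real (card (neighbors G x \<inter> C)) \<in> {0, 1/2 * real (card C), real (card C)})"

text \<open>
  In the following, \<open>v 1, v 2, v 3, v 4\<close> are the four given vertices; other values of
  \<open>v\<close> are irrelevant.
\<close>

definition S_set :: "(nat \<Rightarrow> bit ^ ('n::finite \<times> 2)) \<Rightarrow> (bit ^ ('n \<times> 2)) set"
  where "S_set v = {v 1, v 2, v 3, v 4}"

definition T_set :: "(nat \<Rightarrow> bit ^ ('n::finite \<times> 2)) \<Rightarrow> (bit ^ ('n \<times> 2)) set"
  where "T_set v = {v 1 + v 2, v 2 + v 3, v 3 + v 1}"

definition S_level :: "(nat \<Rightarrow> bit ^ ('n::finite \<times> 2)) \<Rightarrow> nat \<Rightarrow> (bit ^ ('n \<times> 2)) set"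
  where "S_level v i =
    {x \<in> pverts Sp. card {j \<in> {1, 2, 3, 4}. symp_form x (v j) = 1} = i}"

lemma symp_form_expand:
  "symp_form x y = (\<Sum>i\<in>UNIV. x $ (i, 1) * y $ (i, 2) + x $ (i, 2) * y $ (i, 1))"
proof -
  have K_mult: "(K *v y) $ (i, a) = (\<Sum>b\<in>UNIV. R $ a $ b * y $ (i, b))" for i a
  proof -
    have "(K *v y) $ (i, a)
        = (\<Sum>(j, b)\<in>UNIV \<times> UNIV. mat 1 $ i $ j * R $ a $ b * y $ (j, b))"
      by (simp add: K_def kronecker_def matrix_vector_mult_def split_def)
    also have "\<dots> = (\<Sum>j\<in>UNIV. \<Sum>b\<in>UNIV. mat 1 $ i $ j * R $ a $ b * y $ (j, b))"
      by (simp only: sum.cartesian_product)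
    also have "\<dots> = (\<Sum>j\<in>UNIV. if i = j then (\<Sum>b\<in>UNIV. R $ a $ b * y $ (j, b)) else 0)"
      by (rule sum.cong) (auto simp: mat_def)
    finally show ?thesis by simp
  qed
  have "symp_form x y = (\<Sum>(i, a)\<in>UNIV \<times> UNIV. x $ (i, a) * (K *v y) $ (i, a))"
    by (simp add: symp_form_def scalar_product_def split_def)
  also have "\<dots> = (\<Sum>i\<in>UNIV. \<Sum>a\<in>UNIV. x $ (i, a) * (K *v y) $ (i, a))"
    by (simp only: sum.cartesian_product)
  finally show ?thesis
    by (simp add: K_mult sum_2 R_def del: bit_numeral_even)
qed

lemma symp_form_commute: "symp_form x y = symp_form y x"
  unfolding symp_form_expand by (rule sum.cong) (simp_all only: ac_simps)

lemma symp_form_self: "symp_form x x = 0"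
proof -
  have "x $ (i, 1) * x $ (i, 2) + x $ (i, 2) * x $ (i, 1) = 0" for i
    by (cases "x $ (i, 1)"; cases "x $ (i, 2)") simp_all
  then show ?thesis unfolding symp_form_expand by (intro sum.neutral) blast
qed

lemma pair_graph_Sp: "pair_graph Sp"
proof
  show "finite (pverts Sp)" "finite (parcs Sp)" by simp_all
  show "symmetric (with_proj Sp)"
    by (auto simp: symmetric_def sym_def Sp_def symp_form_commute arcs_ends_def
        arc_to_ends_def with_proj_def)
  show "fst e \<noteq> snd e" if "e \<in> parcs Sp" for e
    using that by (auto simp: Sp_def symp_form_self)
qed (auto simp: Sp_def)

end

theory Submission
  imports Defs
begin

text \<open>
  Write \<open>x\<cdot>y\<close> for the symplectic form and let \<open>W = {0} \<union> S \<union> T\<close>, the span of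
  \<open>v\<^sub>1, v\<^sub>2, v\<^sub>3\<close>; it is totally isotropic, and \<open>{0} \<union> S\<^sub>0\<close> is its orthogonal complement.
  Whether a vector lies in \<open>{0} \<union> S\<^sub>0\<close>, \<open>S\<^sub>2\<close> or \<open>S\<^sub>4\<close> depends only on its products with
  \<open>v\<^sub>1, v\<^sub>2, v\<^sub>3\<close>, so each of these three sets is a union of cosets of \<open>W\<^sup>\<bottom>\<close>.

  All the halves come from one device (\<open>card_neighbors_half\<close>): if a set \<open>P\<close> is mapped
  to itself by a translation \<open>y \<mapsto> y + z\<close> with \<open>x\<cdot>z = 1\<close>, the translation exchanges the
  neighbors and the non-neighbors of \<open>x\<close> in \<open>P\<close>, so \<open>x\<close> is adjacent to exactly half of
  \<open>P\<close>.  A suitable \<open>z\<close> always exists, because the form is nondegenerate and hence takes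
  arbitrary prescribed values against a linearly independent set
  (\<open>symp_form_interpolation\<close>):

  \<^item> For \<open>x \<notin> W\<close>, the vectors \<open>v\<^sub>1, v\<^sub>2, v\<^sub>3, x\<close> are independent, so some \<open>z \<in> W\<^sup>\<bottom>\<close> has
    \<open>x\<cdot>z = 1\<close>.  Thus \<open>x\<close> is adjacent to half of each of \<open>{0} \<union> S\<^sub>0\<close>, \<open>S\<^sub>2\<close>, \<open>S\<^sub>4\<close>.  The number
    of neighbors in \<open>S\<^sub>0 - (S \<union> T)\<close> follows by removing \<open>{0} \<union> S \<union> T\<close>, which has 8 elements,
    half of them neighbors of \<open>x\<close> if \<open>x \<in> S\<^sub>2\<close> or \<open>x \<in> S\<^sub>4\<close>, and none if \<open>x \<in> S\<^sub>0\<close>.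
  \<^item> For \<open>x \<in> S\<close>, take \<open>z \<in> S\<^sub>4\<close>: adding \<open>z\<close> flips all four products \<open>y\<cdot>v\<^sub>j\<close>, hence
    preserves \<open>S\<^sub>2\<close>.
  \<^item> For \<open>x \<in> T\<close>, all neighbors of \<open>x\<close> lie in \<open>S\<^sub>2\<close>, and every vertex has as many neighbors
    as non-neighbors in the whole space.

  Altogether every vertex of a cell has the same number of neighbors in each cell, i.e.
  the five cells form an equitable partition.  So the first Godsil--McKay condition holds
  whichever cell is singled out, and the second is contained in the counts above.
\<close>

section \<open>The symplectic form and translations\<close>

lemma add_self_eq_0: "(x :: bit ^ 'm) + x = 0"
  by (simp add: vec_eq_iff)

lemma add_eq_0_iff_eq: "(x :: bit ^ 'm) + y = 0 \<longleftrightarrow> x = y"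
  by (metis add.assoc add_0 add_0_right add_self_eq_0)

lemma symp_form_add_right: "symp_form x (y + z) = symp_form x y + symp_form x z"
  unfolding symp_form_expand sum.distrib[symmetric]
  by (rule sum.cong) (simp_all only: vector_add_component distrib_left ac_simps)

lemma symp_form_add_left: "symp_form (x + y) z = symp_form x z + symp_form y z"
  by (metis symp_form_add_right symp_form_commute)

lemma symp_form_zero: "symp_form 0 x = 0" "symp_form x 0 = 0"
  by (simp_all add: symp_form_expand)

text \<open>
  Prescribing values on an independent set determines a linear functional, and the form,
  being nondegenerate, represents every linear functional by a vector \<open>z\<close>: its coordinates
  are those of the functional with the two entries of each block exchanged, because \<open>K\<close>
  exchanges them back.
\<close>
lemma symp_form_interpolation:
  fixes B :: "(bit ^ ('n::finite \<times> 2)) set"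
  assumes "vec.independent B"
  shows "\<exists>z. \<forall>b\<in>B. symp_form b z = f b"
proof -
  \<comment> \<open>Linear extension yields an endomorphism; the functional is its coordinate at an arbitrary index \<open>k\<close>.\<close>
  define k :: "'n \<times> 2" where "k = undefined"
  obtain g where g: "Vector_Spaces.linear (*s) (*s) g" "\<forall>b\<in>B. g b = axis k (f b)"
    using vec.linear_independent_extend[OF assms, of "\<lambda>b. axis k (f b)"] by blast
  define c where "c = (matrix g :: bit ^ ('n \<times> 2) ^ ('n \<times> 2)) $ k"
  \<comment> \<open>Adding 1 to an index of type \<open>2\<close> exchanges the two entries of a block.\<close>
  define z :: "bit ^ ('n \<times> 2)" where "z = (\<chi> i. c $ (fst i, snd i + 1))"
  have two: "(2::2) + 1 = 1" "(1::2) + 1 = 2" by simp_all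
  have "symp_form x z = g x $ k" for x
  proof -
    have "g x $ k = (matrix g *v x) $ k"
      using matrix_works[OF g(1)] by simp
    also have "\<dots> = (\<Sum>j\<in>UNIV \<times> UNIV. c $ j * x $ j)"
      by (simp add: matrix_vector_mult_def c_def)
    also have "\<dots> = (\<Sum>i\<in>UNIV. \<Sum>a\<in>UNIV. c $ (i, a) * x $ (i, a))"
      by (simp only: sum.cartesian_product split_def prod.collapse)
    also have "\<dots> = symp_form x z"
      by (simp only: symp_form_expand z_def vec_lambda_beta fst_conv snd_conv two sum_2 mult.commute)
    finally show ?thesis by simp
  qed
  with g(2) show ?thesis by (intro exI[of _ z]) simp
qed

lemma neighbors_Sp: "x \<noteq> 0 \<Longrightarrow> neighbors Sp x = {y. symp_form x y = 1}"
  by (auto simp: neighbors_def Sp_def symp_form_zero)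

text \<open>
  Since \<open>x\<cdot>(y + z) = x\<cdot>y + 1\<close>, the translation by \<open>z\<close> is an involution of \<open>P\<close> that exchanges
  the neighbors of \<open>x\<close> with the other elements of \<open>P\<close>.
\<close>
lemma card_neighbors_half:
  fixes x :: "bit ^ ('n::finite \<times> 2)"
  assumes z: "symp_form x z = 1" and P: "\<And>y. y \<in> P \<Longrightarrow> y + z \<in> P"
  shows "2 * card (neighbors Sp x \<inter> P) = card P"
proof -
  let ?N = "neighbors Sp x \<inter> P" and ?M = "P - neighbors Sp x"
  have N: "neighbors Sp x = {y. symp_form x y = 1}"
    using z by (intro neighbors_Sp) (auto simp: symp_form_zero)
  have "bij_betw (\<lambda>y. y + z) ?N ?M"
    by (rule bij_betw_byWitness[where f' = "\<lambda>y. y + z"])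
      (auto simp: N P z symp_form_add_right add.assoc add_self_eq_0)
  then have "card ?N = card ?M" by (rule bij_betw_same_card)
  moreover have "card P = card ?N + card ?M"
    by (subst card_Un_disjoint[symmetric]) (auto intro: arg_cong[where f = card])
  ultimately show ?thesis by simp
qed

section \<open>The partition attached to an isotropic triple\<close>

locale isotropic_triple =
  fixes v :: "nat \<Rightarrow> bit ^ ('n::finite \<times> 2)"
  assumes inj: "inj_on v {1, 2, 3}"
    and indep: "vec.independent (v ` {1, 2, 3})"
    and isotropic: "\<And>i j. i \<in> {1, 2, 3} \<Longrightarrow> j \<in> {1, 2, 3} \<Longrightarrow> symp_form (v i) (v j) = 0"
    and v4: "v 4 = v 1 + v 2 + v 3"
begin

abbreviation S where "S \<equiv> S_set v"
abbreviation T where "T \<equiv> T_set v"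
abbreviation S0 where "S0 \<equiv> S_level v 0"
abbreviation S2 where "S2 \<equiv> S_level v 2"
abbreviation S4 where "S4 \<equiv> S_level v 4"
abbreviation rest where "rest \<equiv> S0 - (S \<union> T)"

\<comment> \<open>Keep the index of \<open>v 1\<close> from being rewritten to \<open>Suc 0\<close>.\<close>
declare One_nat_def [simp del]

lemma span_triple: "vec.span (v ` {1, 2, 3}) \<subseteq> insert 0 (S \<union> T)"
proof
  fix x assume "x \<in> vec.span (v ` {1, 2, 3})"
  then obtain a b c where "x - a *s v 1 - b *s v 2 - c *s v 3 = 0"
    by (auto simp: vec.span_insert)
  then have "x = a *s v 1 + b *s v 2 + c *s v 3"
    by (simp add: algebra_simps)
  then show "x \<in> insert 0 (S \<union> T)"
    by (cases a; cases b; cases c) (auto simp: S_set_def T_set_def v4 add.commute)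
qed

lemma exists_orthogonal_to_triple:
  assumes "x \<notin> insert 0 (S \<union> T)"
  obtains z where "symp_form z (v 1) = 0" "symp_form z (v 2) = 0" "symp_form z (v 3) = 0"
    "symp_form x z = 1"
proof -
  have x: "x \<notin> vec.span (v ` {1, 2, 3})" using assms span_triple by blast
  then have "vec.independent (insert x (v ` {1, 2, 3}))"
    by (rule vec.independent_insertI[OF _ indep])
  from symp_form_interpolation[OF this, of "\<lambda>b. if b = x then 1 else 0"]
  obtain z where z: "\<forall>b\<in>insert x (v ` {1, 2, 3}). symp_form b z = (if b = x then 1 else 0)"
    by blast
  have "v i \<noteq> x" if "i \<in> {1, 2, 3}" for i
    using x vec.span_base[of "v i" "v ` {1, 2, 3}"] that by blast
  with z show thesis by (intro that[of z]) (auto simp: symp_form_commute[of z])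
qed

lemma exists_all_ones:
  obtains z where "symp_form z (v 1) = 1" "symp_form z (v 2) = 1" "symp_form z (v 3) = 1"
proof -
  from symp_form_interpolation[OF indep, of "\<lambda>_. 1"]
  obtain z where "\<forall>b\<in>v ` {1, 2, 3}. symp_form b z = 1" by blast
  then show thesis by (intro that[of z]) (auto simp: symp_form_commute[of z])
qed

text \<open>
  Since \<open>v\<^sub>4\<close> is the sum of the other three, the products of \<open>y\<close> with \<open>v\<^sub>1, \<dots>, v\<^sub>4\<close> contain
  an even number of ones, and the first three products determine that number.
\<close>
lemma mem_S_level:
  "y \<in> S0 \<longleftrightarrow> y \<noteq> 0 \<and> symp_form y (v 1) = 0 \<and> symp_form y (v 2) = 0 \<and> symp_form y (v 3) = 0"
  "y \<in> S2 \<longleftrightarrow> \<not> (symp_form y (v 1) = symp_form y (v 2) \<and> symp_form y (v 2) = symp_form y (v 3))"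
  "y \<in> S4 \<longleftrightarrow> symp_form y (v 1) = 1 \<and> symp_form y (v 2) = 1 \<and> symp_form y (v 3) = 1"
proof -
  have level: "y \<in> S_level v i \<longleftrightarrow> y \<noteq> 0 \<and>
      card ((if symp_form y (v 1) = 1 then {1::nat} else {}) \<union>
        (if symp_form y (v 2) = 1 then {2} else {}) \<union>
        (if symp_form y (v 3) = 1 then {3} else {}) \<union>
        (if symp_form y (v 1) + symp_form y (v 2) + symp_form y (v 3) = 1 then {4} else {})) = i"
    for i
  proof -
    have "{j \<in> {1, 2, 3, 4}. Q j} = (if Q 1 then {1::nat} else {}) \<union> (if Q 2 then {2} else {}) \<union>
        (if Q 3 then {3} else {}) \<union> (if Q 4 then {4} else {})" for Q
      by auto
    then show ?thesis by (simp only: S_level_def v4 symp_form_add_right) (simp add: Sp_def)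
  qed
  show
    "y \<in> S0 \<longleftrightarrow> y \<noteq> 0 \<and> symp_form y (v 1) = 0 \<and> symp_form y (v 2) = 0 \<and> symp_form y (v 3) = 0"
    "y \<in> S2 \<longleftrightarrow> \<not> (symp_form y (v 1) = symp_form y (v 2) \<and> symp_form y (v 2) = symp_form y (v 3))"
    "y \<in> S4 \<longleftrightarrow> symp_form y (v 1) = 1 \<and> symp_form y (v 2) = 1 \<and> symp_form y (v 3) = 1"
    unfolding level
    by (cases "y = 0"; cases "symp_form y (v 1)"; cases "symp_form y (v 2)";
        cases "symp_form y (v 3)"; simp add: symp_form_zero)+
qed

lemma S_level_disjoint: "i \<noteq> j \<Longrightarrow> S_level v i \<inter> S_level v j = {}"
  by (auto simp: S_level_def)

lemma zero_notin_S_level: "0 \<notin> S_level v i"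
  by (simp add: S_level_def Sp_def)

lemma v_distinct: "v 1 \<noteq> v 2" "v 2 \<noteq> v 3" "v 1 \<noteq> v 3"
  using inj by (simp_all add: inj_on_def)

lemma inj4: "inj_on v {1, 2, 3, 4}"
proof -
  have "v 4 = v 1 + (v 2 + v 3)" "v 4 = v 2 + (v 1 + v 3)" "v 4 = v 3 + (v 1 + v 2)"
    by (simp_all only: v4 ac_simps)
  moreover have "v 2 + v 3 \<noteq> 0" "v 1 + v 3 \<noteq> 0" "v 1 + v 2 \<noteq> 0"
    unfolding add_eq_0_iff_eq by (fact v_distinct)+
  ultimately have "v 4 \<noteq> v 1" "v 4 \<noteq> v 2" "v 4 \<noteq> v 3"
    by (metis add_cancel_left_right)+
  then have "v 4 \<notin> v ` {1, 2, 3}" by blast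
  then have "inj_on v (insert 4 {1, 2, 3})" using inj by (subst inj_on_insert) auto
  then show ?thesis by (simp add: insert_commute)
qed

lemma card_S: "card S = 4"
proof -
  have "S = v ` {1, 2, 3, 4}" by (auto simp: S_set_def)
  then show ?thesis using card_image[OF inj4] by simp
qed

lemma T_distinct: "v 1 + v 2 \<noteq> v 2 + v 3" "v 2 + v 3 \<noteq> v 3 + v 1" "v 1 + v 2 \<noteq> v 3 + v 1"
proof -
  show "v 1 + v 2 \<noteq> v 2 + v 3"
    unfolding add.commute[of "v 1" "v 2"] add_left_cancel by (fact v_distinct)
  show "v 2 + v 3 \<noteq> v 3 + v 1"
    unfolding add.commute[of "v 2" "v 3"] add_left_cancel using v_distinct by simp
  show "v 1 + v 2 \<noteq> v 3 + v 1"
    unfolding add.commute[of "v 3" "v 1"] add_left_cancel by (fact v_distinct)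
qed

lemma card_T: "card T = 3"
  using T_distinct by (simp add: T_set_def)

text \<open>A vector with product 1 with each of \<open>v\<^sub>1, v\<^sub>2, v\<^sub>3\<close> has product 1 with \<open>S\<close> and 0 with \<open>T\<close>.\<close>
lemma S_T_disjoint: "S \<inter> T = {}"
proof -
  obtain z where "symp_form z (v 1) = 1" "symp_form z (v 2) = 1" "symp_form z (v 3) = 1"
    by (rule exists_all_ones)
  then have "\<forall>x\<in>S. symp_form z x = 1" "\<forall>x\<in>T. symp_form z x = 0"
    by (simp_all add: S_set_def T_set_def v4 symp_form_add_right)
  then show ?thesis by (metis disjoint_iff zero_neq_one)
qed

lemma S_T_nonzero: "0 \<notin> S \<union> T"
proof -
  obtain z where "symp_form z (v 1) = 1" "symp_form z (v 2) = 1" "symp_form z (v 3) = 1"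
    by (rule exists_all_ones)
  then have "\<forall>x\<in>S. symp_form z x = 1"
    by (simp add: S_set_def v4 symp_form_add_right)
  then have "0 \<notin> S" by (auto simp: symp_form_zero)
  moreover have "v 1 + v 2 \<noteq> 0" "v 2 + v 3 \<noteq> 0" "v 3 + v 1 \<noteq> 0"
    unfolding add_eq_0_iff_eq using v_distinct by simp_all
  ultimately show ?thesis unfolding T_set_def by (metis Un_iff empty_iff insert_iff)
qed

lemma S_T_subset_S0: "S \<union> T \<subseteq> S0"
proof
  fix x assume x: "x \<in> S \<union> T"
  then have "symp_form x (v i) = 0" if "i \<in> {1, 2, 3}" for i
    using that by (auto simp: S_set_def T_set_def v4 symp_form_add_left isotropic)
  with x S_T_nonzero show "x \<in> S0" by (auto simp: mem_S_level)
qed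

lemma S0_orthogonal: "x \<in> S \<union> T \<Longrightarrow> y \<in> S0 \<Longrightarrow> symp_form x y = 0"
  by (auto simp: S_set_def T_set_def v4 mem_S_level symp_form_commute[of x] symp_form_add_right)

section \<open>Counting neighbors\<close>

text \<open>
  Outside \<open>W\<close>: the set \<open>{0} \<union> S\<^sub>0\<close> is invariant under translation by \<open>W\<^sup>\<bottom>\<close>, the set \<open>S\<^sub>0\<close>
  is not, so the zero vector is counted among the non-neighbors.
\<close>
lemma half_outside_span:
  assumes x: "x \<notin> insert 0 (S \<union> T)"
  shows "2 * card (neighbors Sp x \<inter> insert 0 S0) = card (insert 0 S0)"
    and "2 * card (neighbors Sp x \<inter> S2) = card S2"
    and "2 * card (neighbors Sp x \<inter> S4) = card S4"
proof -
  obtain z where z: "symp_form z (v 1) = 0" "symp_form z (v 2) = 0" "symp_form z (v 3) = 0"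
    and xz: "symp_form x z = 1"
    using x by (rule exists_orthogonal_to_triple)
  have "y + z \<in> insert 0 S0" if "y \<in> insert 0 S0" for y
    using that by (auto simp: mem_S_level symp_form_add_left symp_form_zero z)
  then show "2 * card (neighbors Sp x \<inter> insert 0 S0) = card (insert 0 S0)"
    by (rule card_neighbors_half[OF xz])
  show "2 * card (neighbors Sp x \<inter> S2) = card S2" "2 * card (neighbors Sp x \<inter> S4) = card S4"
    by (rule card_neighbors_half[OF xz]; simp only: mem_S_level symp_form_add_left z add_0_right simp_thms)+
qed

text \<open>
  Removing \<open>W = {0} \<union> S \<union> T\<close> from \<open>{0} \<union> S\<^sub>0\<close> leaves \<open>S\<^sub>0 - (S \<union> T)\<close>; the constant 8 is the
  size of \<open>W\<close>.
\<close>
lemma half_outside_span_rest: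
  assumes x: "x \<notin> insert 0 (S \<union> T)"
  shows "2 * (card (neighbors Sp x \<inter> S) + card (neighbors Sp x \<inter> T) + card (neighbors Sp x \<inter> rest))
    = 8 + card rest"
proof -
  have "0 \<notin> neighbors Sp x" by (simp add: neighbors_def Sp_def)
  then have "neighbors Sp x \<inter> insert 0 S0 =
      neighbors Sp x \<inter> S \<union> neighbors Sp x \<inter> T \<union> neighbors Sp x \<inter> rest"
    using S_T_subset_S0 by blast
  moreover have "card (neighbors Sp x \<inter> S \<union> neighbors Sp x \<inter> T \<union> neighbors Sp x \<inter> rest) =
      card (neighbors Sp x \<inter> S) + card (neighbors Sp x \<inter> T) + card (neighbors Sp x \<inter> rest)"
    using S_T_disjoint by (subst card_Un_disjoint; (subst card_Un_disjoint)?; auto)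
  moreover have "card (insert 0 S0) = 8 + card rest"
  proof -
    have "card (S \<union> T) = 7"
      using card_Un_disjoint[of S T] S_T_disjoint card_S card_T by simp
    moreover have "card S0 = card (S \<union> T) + card rest"
      using S_T_subset_S0 by (metis card_Diff_subset card_mono finite le_add_diff_inverse)
    moreover have "0 \<notin> S0" by (rule zero_notin_S_level)
    ultimately show ?thesis by simp
  qed
  ultimately show ?thesis using half_outside_span(1)[OF x] by simp
qed

lemma card_neighbors_S_of_level:
  assumes "x \<in> S_level v i"
  shows "card (neighbors Sp x \<inter> S) = i"
proof -
  let ?J = "{j \<in> {1, 2, 3, 4}. symp_form x (v j) = 1}"
  have "neighbors Sp x = {y. symp_form x y = 1}"
    using assms by (intro neighbors_Sp) (simp add: S_level_def Sp_def)
  then have "neighbors Sp x \<inter> S = v ` ?J" by (auto simp: S_set_def)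
  moreover have "inj_on v ?J" by (rule inj_on_subset[OF inj4]) auto
  ultimately show ?thesis using assms by (simp add: card_image S_level_def)
qed

text \<open>
  The five lemmas below give the rows of the quotient matrix, except that the row of \<open>T\<close>
  relates the degree to the size of the whole space.
\<close>
lemma counts_S:
  assumes "x \<in> S"
  shows "card (neighbors Sp x \<inter> S) = 0" "card (neighbors Sp x \<inter> T) = 0"
    "card (neighbors Sp x \<inter> rest) = 0" "2 * card (neighbors Sp x \<inter> S2) = card S2"
    "card (neighbors Sp x \<inter> S4) = card S4"
proof -
  have N: "neighbors Sp x = {y. symp_form x y = 1}"
    using assms S_T_nonzero by (intro neighbors_Sp) auto
  have "neighbors Sp x \<inter> S0 = {}" using assms S0_orthogonal by (fastforce simp: N)
  then have "neighbors Sp x \<inter> S = {}" "neighbors Sp x \<inter> T = {}" "neighbors Sp x \<inter> rest = {}"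
    using S_T_subset_S0 by blast+
  then show "card (neighbors Sp x \<inter> S) = 0" "card (neighbors Sp x \<inter> T) = 0"
    "card (neighbors Sp x \<inter> rest) = 0" by (simp_all only: card.empty)
  have S4: "symp_form x y = 1" if "y \<in> S4" for y
    using assms that
    by (auto simp: S_set_def v4 symp_form_commute[of _ y] symp_form_add_right mem_S_level)
  then have "neighbors Sp x \<inter> S4 = S4" by (auto simp: N)
  then show "card (neighbors Sp x \<inter> S4) = card S4" by simp
  obtain z where z: "symp_form z (v 1) = 1" "symp_form z (v 2) = 1" "symp_form z (v 3) = 1"
    by (rule exists_all_ones)
  then have xz: "symp_form x z = 1" by (simp add: S4 mem_S_level)
  show "2 * card (neighbors Sp x \<inter> S2) = card S2"
    by (rule card_neighbors_half[OF xz])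
      (simp only: mem_S_level symp_form_add_left z add_right_cancel simp_thms)
qed

lemma counts_T:
  assumes "x \<in> T"
  shows "card (neighbors Sp x \<inter> S) = 0" "card (neighbors Sp x \<inter> T) = 0"
    "card (neighbors Sp x \<inter> rest) = 0"
    "2 * card (neighbors Sp x \<inter> S2) = card (UNIV :: (bit ^ ('n \<times> 2)) set)"
    "card (neighbors Sp x \<inter> S4) = 0"
proof -
  have x0: "x \<noteq> 0" using assms S_T_nonzero by auto
  have N: "neighbors Sp x = {y. symp_form x y = 1}" by (rule neighbors_Sp[OF x0])
  have sub: "neighbors Sp x \<subseteq> S2"
    using assms
    by (auto simp: N T_set_def mem_S_level symp_form_add_left symp_form_commute[of "v _"])
  have "S2 \<inter> S0 = {}" "S2 \<inter> S4 = {}" by (simp_all add: S_level_disjoint)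
  then have "neighbors Sp x \<inter> S = {}" "neighbors Sp x \<inter> T = {}" "neighbors Sp x \<inter> rest = {}"
    "neighbors Sp x \<inter> S4 = {}"
    using sub S_T_subset_S0 by blast+
  then show "card (neighbors Sp x \<inter> S) = 0" "card (neighbors Sp x \<inter> T) = 0"
    "card (neighbors Sp x \<inter> rest) = 0" "card (neighbors Sp x \<inter> S4) = 0"
    by (simp_all only: card.empty)
  have "vec.independent {x}" using x0 by simp
  from symp_form_interpolation[OF this, of "\<lambda>_. 1"]
  obtain z where "symp_form x z = 1" by auto
  then have "2 * card (neighbors Sp x \<inter> UNIV) = card (UNIV :: (bit ^ ('n \<times> 2)) set)"
    by (rule card_neighbors_half) simp
  moreover have "neighbors Sp x \<inter> S2 = neighbors Sp x \<inter> UNIV" using sub by blast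
  ultimately show "2 * card (neighbors Sp x \<inter> S2) = card (UNIV :: (bit ^ ('n \<times> 2)) set)"
    by simp
qed

lemma counts_rest:
  assumes "x \<in> rest"
  shows "card (neighbors Sp x \<inter> S) = 0" "card (neighbors Sp x \<inter> T) = 0"
    "2 * card (neighbors Sp x \<inter> rest) = card rest + 8"
    "2 * card (neighbors Sp x \<inter> S2) = card S2"
    "2 * card (neighbors Sp x \<inter> S4) = card S4"
proof -
  have x: "x \<notin> insert 0 (S \<union> T)" using assms by (auto simp: mem_S_level)
  show S: "card (neighbors Sp x \<inter> S) = 0"
    using assms card_neighbors_S_of_level by blast
  have "neighbors Sp x = {y. symp_form x y = 1}" using x by (intro neighbors_Sp) auto
  then have "neighbors Sp x \<inter> T = {}"
    using assms S0_orthogonal by (fastforce simp: symp_form_commute[of x])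
  then show T: "card (neighbors Sp x \<inter> T) = 0" by simp
  show "2 * card (neighbors Sp x \<inter> rest) = card rest + 8"
    using half_outside_span_rest[OF x] S T by simp
  show "2 * card (neighbors Sp x \<inter> S2) = card S2" "2 * card (neighbors Sp x \<inter> S4) = card S4"
    by (fact half_outside_span[OF x])+
qed

lemma counts_S2:
  assumes "x \<in> S2"
  shows "card (neighbors Sp x \<inter> S) = 2" "card (neighbors Sp x \<inter> T) = 2"
    "2 * card (neighbors Sp x \<inter> rest) = card rest"
    "2 * card (neighbors Sp x \<inter> S2) = card S2"
    "2 * card (neighbors Sp x \<inter> S4) = card S4"
proof -
  have "S2 \<inter> insert 0 S0 = {}" by (simp add: S_level_disjoint zero_notin_S_level)
  then have x: "x \<notin> insert 0 (S \<union> T)" using assms S_T_subset_S0 by blast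
  show S: "card (neighbors Sp x \<inter> S) = 2"
    using assms by (rule card_neighbors_S_of_level)
  have N: "neighbors Sp x = {y. symp_form x y = 1}" using x by (intro neighbors_Sp) auto
  show T: "card (neighbors Sp x \<inter> T) = 2"
    using assms unfolding N T_set_def mem_S_level
    by (cases "symp_form x (v 1)"; cases "symp_form x (v 2)"; cases "symp_form x (v 3)")
      (use T_distinct in \<open>simp_all add: Int_insert_right symp_form_add_right\<close>)
  show "2 * card (neighbors Sp x \<inter> rest) = card rest"
    using half_outside_span_rest[OF x] S T by simp
  show "2 * card (neighbors Sp x \<inter> S2) = card S2" "2 * card (neighbors Sp x \<inter> S4) = card S4"
    by (fact half_outside_span[OF x])+
qed

lemma counts_S4:
  assumes "x \<in> S4"
  shows "card (neighbors Sp x \<inter> S) = 4" "card (neighbors Sp x \<inter> T) = 0"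
    "2 * card (neighbors Sp x \<inter> rest) = card rest"
    "2 * card (neighbors Sp x \<inter> S2) = card S2"
    "2 * card (neighbors Sp x \<inter> S4) = card S4"
proof -
  have "S4 \<inter> insert 0 S0 = {}" by (simp add: S_level_disjoint zero_notin_S_level)
  then have x: "x \<notin> insert 0 (S \<union> T)" using assms S_T_subset_S0 by blast
  show S: "card (neighbors Sp x \<inter> S) = 4"
    using assms by (rule card_neighbors_S_of_level)
  have "neighbors Sp x = {y. symp_form x y = 1}" using x by (intro neighbors_Sp) auto
  then have "neighbors Sp x \<inter> T = {}"
    using assms by (auto simp: T_set_def mem_S_level symp_form_add_right)
  then show T: "card (neighbors Sp x \<inter> T) = 0" by simp
  show "2 * card (neighbors Sp x \<inter> rest) = card rest"
    using half_outside_span_rest[OF x] S T by simp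
  show "2 * card (neighbors Sp x \<inter> S2) = card S2" "2 * card (neighbors Sp x \<inter> S4) = card S4"
    by (fact half_outside_span[OF x])+
qed

section \<open>Godsil--McKay cells\<close>

lemma cells_equitable:
  assumes "A \<in> {S, T, rest, S2, S4}" "B \<in> {S, T, rest, S2, S4}" "x \<in> A" "y \<in> A"
  shows "card (neighbors Sp x \<inter> B) = card (neighbors Sp y \<inter> B)"
proof -
  consider "A = S" | "A = T" | "A = rest" | "A = S2" | "A = S4" using assms(1) by blast
  then show ?thesis
  proof cases
    case 1
    then show ?thesis using assms(2) counts_S[of x] counts_S[of y] assms(3,4) by auto
  next
    case 2
    then show ?thesis using assms(2) counts_T[of x] counts_T[of y] assms(3,4) by auto
  next
    case 3
    then have "x \<in> rest" "y \<in> rest" using assms(3,4) by simp_all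
    from counts_rest[OF this(1)] counts_rest[OF this(2)] show ?thesis
      using assms(2) by auto
  next
    case 4
    then show ?thesis using assms(2) counts_S2[of x] counts_S2[of y] assms(3,4) by auto
  next
    case 5
    then show ?thesis using assms(2) counts_S4[of x] counts_S4[of y] assms(3,4) by auto
  qed
qed

lemma Union_cells: "\<Union>{S, T, rest, S2, S4} = pverts Sp"
proof -
  have "\<Union>{S, T, rest, S2, S4} = S0 \<union> S2 \<union> S4" using S_T_subset_S0 by auto
  also have "\<dots> = pverts Sp"
  proof
    show "S0 \<union> S2 \<union> S4 \<subseteq> pverts Sp" by (auto simp: S_level_def)
    show "pverts Sp \<subseteq> S0 \<union> S2 \<union> S4" by (auto simp: mem_S_level Sp_def)
  qed
  finally show ?thesis .
qed

lemma disjoint_cells: "disjoint {S, T, rest, S2, S4}"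
proof -
  have "S0 \<inter> S2 = {}" "S0 \<inter> S4 = {}" "S2 \<inter> S4 = {}"
    by (simp_all add: S_level_disjoint)
  then have d: "S \<inter> S2 = {}" "S \<inter> S4 = {}" "T \<inter> S2 = {}" "T \<inter> S4 = {}"
    "rest \<inter> S2 = {}" "rest \<inter> S4 = {}" "S2 \<inter> S4 = {}" "S \<inter> rest = {}" "T \<inter> rest = {}"
    using S_T_subset_S0 by blast+
  show ?thesis
    by (rule disjointI)
      (elim insertE emptyE; use d S_T_disjoint in \<open>simp add: Int_commute\<close>)
qed

text \<open>The partition being equitable, the first Godsil--McKay condition holds for every choice of \<open>D\<close>.\<close>
lemma godsil_mckay_cellI:
  assumes "D \<in> {S, T, rest, S2, S4}"
    and "\<And>x C. x \<in> D \<Longrightarrow> C \<in> {S, T, rest, S2, S4} - {D} \<Longrightarrow>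
      real (card (neighbors Sp x \<inter> C)) \<in> {0, 1/2 * real (card C), real (card C)}"
  shows "godsil_mckay_cell Sp {S, T, rest, S2, S4} D"
  unfolding godsil_mckay_cell_def
proof (intro conjI ballI)
  show "finite {S, T, rest, S2, S4}" by simp
  show "\<Union>{S, T, rest, S2, S4} = pverts Sp" by (rule Union_cells)
  show "disjoint {S, T, rest, S2, S4}" by (rule disjoint_cells)
  show "card (neighbors Sp x \<inter> B) = card (neighbors Sp y \<inter> B)"
    if "A \<in> {S, T, rest, S2, S4} - {D}" "B \<in> {S, T, rest, S2, S4} - {D}" "x \<in> A" "y \<in> A"
    for A B x y
    by (rule cells_equitable) (use that in auto)
qed (fact assms)+

lemma double_eq_imp_real_half: "2 * m = n \<Longrightarrow> real m = 1/2 * real n"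
  by auto

lemma neighbors_of_S:
  assumes "x \<in> S"
  shows "\<forall>P \<in> {T, rest}. card (neighbors Sp x \<inter> P) = 0"
    "card (neighbors Sp x \<inter> S4) = card S4"
    "real (card (neighbors Sp x \<inter> S2)) = 1/2 * real (card S2)"
  by (simp_all only: ball_simps ball_empty counts_S[OF assms]
      counts_S(4)[OF assms, THEN double_eq_imp_real_half] simp_thms)

lemma neighbors_of_S4:
  assumes "x \<in> S4"
  shows "card (neighbors Sp x \<inter> T) = 0" "card (neighbors Sp x \<inter> S) = card S"
    "\<forall>P \<in> {S2, rest}. real (card (neighbors Sp x \<inter> P)) = 1/2 * real (card P)"
  by (simp_all only: ball_simps ball_empty counts_S4(1,2)[OF assms] card_S
      counts_S4(3,4)[OF assms, THEN double_eq_imp_real_half] simp_thms)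

lemma neighbors_of_rest:
  assumes "x \<in> rest"
  shows "\<forall>P \<in> {S, T}. card (neighbors Sp x \<inter> P) = 0"
    "\<forall>P \<in> {S2, S4}. real (card (neighbors Sp x \<inter> P)) = 1/2 * real (card P)"
  by (simp_all only: ball_simps ball_empty counts_rest(1,2)[OF assms]
      counts_rest(4,5)[OF assms, THEN double_eq_imp_real_half] simp_thms)

lemma godsil_mckay_cell_S: "godsil_mckay_cell Sp {S, T, rest, S2, S4} S"
proof (rule godsil_mckay_cellI)
  fix x C assume x: "x \<in> S" and "C \<in> {S, T, rest, S2, S4} - {S}"
  then have "C \<in> {T, rest, S2, S4}" by blast
  then show "real (card (neighbors Sp x \<inter> C)) \<in> {0, 1/2 * real (card C), real (card C)}"
    using neighbors_of_S[OF x] by auto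
qed simp

lemma godsil_mckay_cell_rest: "godsil_mckay_cell Sp {S, T, rest, S2, S4} rest"
proof (rule godsil_mckay_cellI)
  fix x C assume x: "x \<in> rest" and "C \<in> {S, T, rest, S2, S4} - {rest}"
  then have "C \<in> {S, T, S2, S4}" by blast
  then show "real (card (neighbors Sp x \<inter> C)) \<in> {0, 1/2 * real (card C), real (card C)}"
    using neighbors_of_rest[OF x] by auto
qed simp

lemma godsil_mckay_cell_S4: "godsil_mckay_cell Sp {S, T, rest, S2, S4} S4"
proof (rule godsil_mckay_cellI)
  fix x C assume x: "x \<in> S4" and "C \<in> {S, T, rest, S2, S4} - {S4}"
  then have "C \<in> {S, T, rest, S2}" by blast
  then show "real (card (neighbors Sp x \<inter> C)) \<in> {0, 1/2 * real (card C), real (card C)}"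
    using neighbors_of_S4[OF x] by auto
qed simp

end

theorem proposition4p7:
  fixes v :: "nat \<Rightarrow> bit ^ ('n::finite \<times> 2)"
  assumes "CARD('n) \<ge> 3"
    and "S_set v \<subseteq> pverts Sp"
    and "inj_on v {1, 2, 3}" and "vec.independent (v ` {1, 2, 3})"
    and "\<forall>i \<in> {1, 2, 3}. \<forall>j \<in> {1, 2, 3}. symp_form (v i) (v j) = 0"
    and "v 4 = v 1 + v 2 + v 3"
  defines "X \<equiv> (Sp :: (bit ^ ('n \<times> 2)) pair_pre_digraph)"
    and "S \<equiv> S_set v" and "T \<equiv> T_set v"
    and "S0 \<equiv> S_level v 0" and "S2 \<equiv> S_level v 2" and "S4 \<equiv> S_level v 4"
  shows
    "(\<forall>x \<in> S.
        (\<forall>P \<in> {T, S0 - (S \<union> T)}. card (neighbors X x \<inter> P) = 0) \<and>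
        card (neighbors X x \<inter> S4) = card S4 \<and>
        real (card (neighbors X x \<inter> S2)) = 1/2 * real (card S2)) \<and>
     (\<forall>x \<in> S4.
        card (neighbors X x \<inter> T) = 0 \<and>
        card (neighbors X x \<inter> S) = card S \<and>
        (\<forall>P \<in> {S2, S0 - (S \<union> T)}.
           real (card (neighbors X x \<inter> P)) = 1/2 * real (card P))) \<and>
     (\<forall>x \<in> S0 - (S \<union> T).
        (\<forall>P \<in> {S, T}. card (neighbors X x \<inter> P) = 0) \<and>
        (\<forall>P \<in> {S2, S4}.
           real (card (neighbors X x \<inter> P)) = 1/2 * real (card P))) \<and>
     (\<forall>D \<in> {S, S0 - (S \<union> T), S4}.
        godsil_mckay_cell X {S, T, S0 - (S \<union> T), S2, S4} D)"
proof -
  interpret isotropic_triple v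
    using assms(3-6) by unfold_locales auto
  show ?thesis
    unfolding assms(7-12)
    using neighbors_of_S neighbors_of_S4 neighbors_of_rest
      godsil_mckay_cell_S godsil_mckay_cell_rest godsil_mckay_cell_S4
    by (simp only: ball_simps ball_empty simp_thms) blast
qed

end
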